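(* For classic online bin packing, every Any-Fit algorithm has (asymptotic) online bounded ratio at least $\frac32$.
   Context: Classic bin packing: items with sizes in $(0,1]$ arrive online and each must be irrevocably placed in a bin of capacity $1$ (total size in a bin at most $1$); the cost is the number of bins used (a bin is open once it contains an item). An Any-Fit algorithm never opens a new bin if the current item fits in an already open bin. For a deterministic online algorithm $A$, $\textsc{Opt}_A$ denotes an offline algorithm that is optimal among offline algorithms whose packing of any input $I$ satisfies, for every prefix $I'$ of $I$, that the number of bins it uses for the items of $I'$ is at most $A(I')$. The asymptotic online bounded ratio of $A$ is the infimum of all $c$ for which there is a constant $\alpha$ with $A(I)\le c\,\textsc{Opt}_A(I)+\alpha$ for all inputs $I$. *)

theory Defs
  imports Complex_Main "HOL-Library.Extended_Real"
begin

text \<open>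
  An input is the list of its item sizes, in order of arrival. A packing of an input maps item
  positions to bin labels; only its values at positions below the length of the input matter.
\<close>

definition valid_input :: "real list \<Rightarrow> bool" where
  "valid_input I \<longleftrightarrow> set I \<subseteq> {0<..1}"

definition load :: "real list \<Rightarrow> (nat \<Rightarrow> nat) \<Rightarrow> nat \<Rightarrow> real" where
  "load I p b = (\<Sum>i | i < length I \<and> p i = b. I ! i)"

definition is_packing :: "real list \<Rightarrow> (nat \<Rightarrow> nat) \<Rightarrow> bool" where
  "is_packing I p \<longleftrightarrow> (\<forall>b. load I p b \<le> 1)"

definition open_bins :: "(nat \<Rightarrow> nat) \<Rightarrow> nat \<Rightarrow> nat set" where
  "open_bins p k = p ` {..<k}"

text \<open>
  A deterministic online algorithm is a function \<open>A\<close> mapping each nonempty sequence of items seen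
  so far to the bin in which its last item is placed. Its own earlier decisions are determined by
  that sequence, so they need not be passed to it.
\<close>

definition online_packing :: "(real list \<Rightarrow> nat) \<Rightarrow> real list \<Rightarrow> nat \<Rightarrow> nat" where
  "online_packing A I i = A (take (Suc i) I)"

definition online_algorithm :: "(real list \<Rightarrow> nat) \<Rightarrow> bool" where
  "online_algorithm A \<longleftrightarrow> (\<forall>I. valid_input I \<longrightarrow> is_packing I (online_packing A I))"

definition cost :: "(real list \<Rightarrow> nat) \<Rightarrow> real list \<Rightarrow> nat" where
  "cost A I = card (open_bins (online_packing A I) (length I))"

definition any_fit :: "(real list \<Rightarrow> nat) \<Rightarrow> bool" where
  "any_fit A \<longleftrightarrow> online_algorithm A \<and>
    (\<forall>I x. valid_input (I @ [x]) \<longrightarrow>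
      (\<exists>b \<in> open_bins (online_packing A I) (length I). load I (online_packing A I) b + x \<le> 1) \<longrightarrow>
      A (I @ [x]) \<in> open_bins (online_packing A I) (length I))"

definition bounded_packing :: "(real list \<Rightarrow> nat) \<Rightarrow> real list \<Rightarrow> (nat \<Rightarrow> nat) \<Rightarrow> bool" where
  "bounded_packing A I p \<longleftrightarrow> is_packing I p \<and>
    (\<forall>k \<le> length I. card (open_bins p k) \<le> cost A (take k I))"

definition opt_cost :: "(real list \<Rightarrow> nat) \<Rightarrow> real list \<Rightarrow> nat" where
  "opt_cost A I = (LEAST n. \<exists>p. bounded_packing A I p \<and> card (open_bins p (length I)) = n)"

text \<open>
  The minimum in \<^const>\<open>opt_cost\<close> is attained: the packing produced by \<open>A\<close> itself is admissible.
  As an offline algorithm may choose its packing of each input independently, choosing a minimal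
  admissible packing for every input yields one that is optimal on all inputs simultaneously.
\<close>

lemma bounded_packing_online:
  assumes "online_algorithm A" "valid_input I"
  shows "bounded_packing A I (online_packing A I)"
proof -
  have "open_bins (online_packing A I) k
      = open_bins (online_packing A (take k I)) (length (take k I))" if "k \<le> length I" for k
    using that unfolding open_bins_def online_packing_def
    by (intro image_cong) (auto simp: min_absorb1 min_absorb2 Suc_leI)
  then show ?thesis
    using assms unfolding bounded_packing_def online_algorithm_def cost_def by simp
qed

lemma opt_cost_attained:
  assumes "online_algorithm A"
  shows "\<exists>B. \<forall>I. valid_input I \<longrightarrow>
    bounded_packing A I (B I) \<and> card (open_bins (B I) (length I)) = opt_cost A I"
proof -
  have "\<exists>p. bounded_packing A I p \<and> card (open_bins p (length I)) = opt_cost A I"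
    if "valid_input I" for I
    unfolding opt_cost_def by (rule LeastI_ex) (use bounded_packing_online[OF assms that] in blast)
  then show ?thesis by metis
qed

lemma opt_cost_le: "bounded_packing A I p \<Longrightarrow> opt_cost A I \<le> card (open_bins p (length I))"
  unfolding opt_cost_def by (rule Least_le) blast

text \<open>Extended reals are used so that the infimum is infinite if no \<open>c\<close> qualifies.\<close>

definition online_bounded_ratio :: "(real list \<Rightarrow> nat) \<Rightarrow> ereal" where
  "online_bounded_ratio A = Inf {ereal c | c. \<exists>\<alpha>::real. \<forall>I. valid_input I \<longrightarrow>
     real (cost A I) \<le> c * real (opt_cost A I) + \<alpha>}"

end

theory Submission imports Defs begin

text \<open>
  Call the number of bins in which an Any-Fit packing exceeds an admissible offline packing the
  waste. Suppose the waste is \<open>w\<close> and all bins of the algorithm have load at least \<open>1/2 + 2\<epsilon>\<close>.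
  Present \<open>2w\<close> items of size \<open>1/2 - \<epsilon>\<close>: the algorithm has to pack them in pairs, while the
  waste just suffices for the offline packing to put each into a bin of its own. Then present
  \<open>2w\<close> items of size \<open>1/2 + \<epsilon>\<close>: the algorithm opens a new bin for each, and the offline packing
  opens none. The algorithm has used \<open>3w\<close> new bins against \<open>2w\<close> offline, so the waste has
  doubled, and all loads are at least \<open>1/2 + \<epsilon>\<close>. Iterating drives the ratio to \<open>3/2\<close>.
  A first waste of 1 is obtained from the items \<open>0.4, 0.7, 0.2\<close>, by continuing according to
  the bin in which the algorithm places the third one.
\<close>

section \<open>Effect of one more item on loads, open bins and admissibility\<close>

lemma valid_input_snoc: "valid_input (I @ [x]) \<longleftrightarrow> valid_input I \<and> 0 < x \<and> x \<le> 1"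
  by (auto simp: valid_input_def)

lemma load_snoc:
  assumes "\<And>i. i < length I \<Longrightarrow> q i = p i"
  shows "load (I @ [x]) q = (load I p)(q (length I) := load I p (q (length I)) + x)"
proof
  fix b
  have eq: "{i. i < length (I @ [x]) \<and> q i = b}
      = {i. i < length I \<and> p i = b} \<union> (if q (length I) = b then {length I} else {})"
    using assms by (auto simp: less_Suc_eq)
  have "load (I @ [x]) q b = (\<Sum>i | i < length I \<and> p i = b. (I @ [x]) ! i)
      + (\<Sum>i\<in>(if q (length I) = b then {length I} else {}). (I @ [x]) ! i)"
    unfolding load_def eq by (rule sum.union_disjoint) auto
  also have "(\<Sum>i | i < length I \<and> p i = b. (I @ [x]) ! i) = load I p b"
    unfolding load_def by (intro sum.cong) (auto simp: nth_append)
  finally show "load (I @ [x]) q b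
      = ((load I p)(q (length I) := load I p (q (length I)) + x)) b"
    by auto
qed

lemma load_outside: "b \<notin> open_bins p (length I) \<Longrightarrow> load I p b = 0"
  unfolding load_def open_bins_def by (intro sum.neutral) auto

lemma open_bins_Suc: "open_bins p (Suc k) = insert (p k) (open_bins p k)"
  by (auto simp: open_bins_def less_Suc_eq)

lemma open_bins_cong: "(\<And>i. i < k \<Longrightarrow> p i = q i) \<Longrightarrow> open_bins p k = open_bins q k"
  by (auto simp: open_bins_def)

lemma finite_open_bins: "finite (open_bins p k)"
  by (simp add: open_bins_def)

lemma online_packing_snoc: "i < length I \<Longrightarrow> online_packing A (I @ [x]) i = online_packing A I i"
  by (simp add: online_packing_def Suc_leI)

lemma online_packing_length: "online_packing A (I @ [x]) (length I) = A (I @ [x])"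
  by (simp add: online_packing_def)

lemma open_bins_online_snoc:
  "open_bins (online_packing A (I @ [x])) (length (I @ [x]))
    = insert (A (I @ [x])) (open_bins (online_packing A I) (length I))"
  using open_bins_cong[of "length I" "online_packing A (I @ [x])" "online_packing A I"]
  by (simp add: open_bins_Suc online_packing_length online_packing_snoc)

lemma load_online_snoc:
  "load (I @ [x]) (online_packing A (I @ [x]))
    = (load I (online_packing A I))(A (I @ [x]) := load I (online_packing A I) (A (I @ [x])) + x)"
  using load_snoc[of I "online_packing A (I @ [x])" "online_packing A I" x]
  by (simp add: online_packing_snoc online_packing_length)

lemma bounded_packing_snoc:
  assumes "bounded_packing A I p" and fits: "load I p c + x \<le> 1"
    and card: "card (insert c (open_bins p (length I))) \<le> cost A (I @ [x])"
  shows "bounded_packing A (I @ [x]) (p(length I := c))"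
proof -
  let ?q = "p(length I := c)"
  have "is_packing (I @ [x]) ?q"
    using assms(1) fits load_snoc[of I ?q p x] by (simp add: bounded_packing_def is_packing_def)
  moreover have "card (open_bins ?q k) \<le> cost A (take k (I @ [x]))"
    if "k \<le> length (I @ [x])" for k
  proof (cases "k \<le> length I")
    case True
    then have "open_bins ?q k = open_bins p k" by (intro open_bins_cong) auto
    then show ?thesis using True assms(1) by (simp add: bounded_packing_def)
  next
    case False
    then have "k = Suc (length I)" using that by simp
    moreover have "open_bins ?q (length I) = open_bins p (length I)"
      by (intro open_bins_cong) auto
    ultimately show ?thesis using card by (simp add: open_bins_Suc)
  qed
  ultimately show ?thesis by (simp add: bounded_packing_def)
qed

section \<open>Configurations of the game between algorithm and offline packing\<close>

text \<open>The input is hidden: the adversary's moves depend only on the open bins and loads of the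
  algorithm (\<open>B\<close>, \<open>f\<close>) and of some admissible offline packing
  (\<open>C\<close>, \<open>g\<close>).\<close>

definition reachable ::
  "(real list \<Rightarrow> nat) \<Rightarrow> nat set \<Rightarrow> (nat \<Rightarrow> real) \<Rightarrow> nat set \<Rightarrow> (nat \<Rightarrow> real) \<Rightarrow> bool" where
  "reachable A B f C g \<longleftrightarrow> (\<exists>I p. valid_input I \<and> bounded_packing A I p \<and>
     open_bins (online_packing A I) (length I) = B \<and> load I (online_packing A I) = f \<and>
     open_bins p (length I) = C \<and> load I p = g)"

lemma reachable_empty: "reachable A {} (\<lambda>_. 0) {} (\<lambda>_. 0)"
  unfolding reachable_def
  by (intro exI[of _ "[]"] exI[of _ "\<lambda>_. 0"])
    (auto simp: valid_input_def bounded_packing_def is_packing_def load_def open_bins_def)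

lemma reachable_finite:
  assumes "reachable A B f C g"
  shows "finite B" "finite C"
  using assms by (auto simp: reachable_def finite_open_bins)

lemma reachable_outside:
  assumes "reachable A B f C g"
  shows "b \<notin> B \<Longrightarrow> f b = 0" "c \<notin> C \<Longrightarrow> g c = 0"
  using assms by (auto simp: reachable_def load_outside)

lemma reachable_card_le: "reachable A B f C g \<Longrightarrow> card C \<le> card B"
  by (auto simp: reachable_def bounded_packing_def cost_def)

text \<open>The algorithm sees only the items, so its bin \<open>d\<close> is fixed before the
  offline bin \<open>c\<close> is chosen. Hence \<open>c\<close> is quantified inside and may depend
  on \<open>d\<close>.\<close>

lemma reachable_step:
  assumes A: "any_fit A" and r: "reachable A B f C g" and x: "0 < x" "x \<le> 1"
  shows "\<exists>d. f d + x \<le> 1 \<and> ((\<exists>b\<in>B. f b + x \<le> 1) \<longrightarrow> d \<in> B) \<and>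
    (\<forall>c. g c + x \<le> 1 \<longrightarrow> card (insert c C) \<le> card (insert d B) \<longrightarrow>
      reachable A (insert d B) (f(d := f d + x)) (insert c C) (g(c := g c + x)))"
proof -
  obtain I p where I: "valid_input I" and p: "bounded_packing A I p"
    and B: "open_bins (online_packing A I) (length I) = B" and f: "load I (online_packing A I) = f"
    and C: "open_bins p (length I) = C" and g: "load I p = g"
    using r unfolding reachable_def by blast
  let ?d = "A (I @ [x])"
  have I': "valid_input (I @ [x])" using I x by (simp add: valid_input_snoc)
  have B': "open_bins (online_packing A (I @ [x])) (length (I @ [x])) = insert ?d B"
    using B by (simp only: open_bins_online_snoc)
  have f': "load (I @ [x]) (online_packing A (I @ [x])) = f(?d := f ?d + x)"
    using f by (simp only: load_online_snoc)
  have "is_packing (I @ [x]) (online_packing A (I @ [x]))"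
    using A I' unfolding any_fit_def online_algorithm_def by blast
  then have "f ?d + x \<le> 1" unfolding is_packing_def f' by (metis fun_upd_same)
  moreover have "(\<exists>b\<in>B. f b + x \<le> 1) \<longrightarrow> ?d \<in> B"
    using A I' B f unfolding any_fit_def by blast
  moreover have "reachable A (insert ?d B) (f(?d := f ?d + x)) (insert c C) (g(c := g c + x))"
    if c: "g c + x \<le> 1" "card (insert c C) \<le> card (insert ?d B)" for c
  proof -
    let ?q = "p(length I := c)"
    have "bounded_packing A (I @ [x]) ?q"
      using p c B' C g by (intro bounded_packing_snoc) (simp_all add: cost_def)
    moreover have "open_bins ?q (length (I @ [x])) = insert c C"
      using C open_bins_cong[of "length I" ?q p] by (simp add: open_bins_Suc)
    moreover have "load (I @ [x]) ?q = g(c := g c + x)"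
      using g load_snoc[of I ?q p x] by simp
    ultimately show ?thesis
      unfolding reachable_def using I' B' f' by blast
  qed
  ultimately show ?thesis by blast
qed

lemma reachable_new_bin:
  assumes A: "any_fit A" and r: "reachable A B f C g" and x: "0 < x" "x \<le> 1"
    and full: "\<forall>b\<in>B. f b + x > 1"
    and c: "g c + x \<le> 1" "card (insert c C) \<le> Suc (card B)"
  shows "\<exists>d. d \<notin> B \<and> reachable A (insert d B) (f(d := x)) (insert c C) (g(c := g c + x))"
proof -
  obtain d where d: "f d + x \<le> 1" and step: "card (insert c C) \<le> card (insert d B) \<Longrightarrow>
      reachable A (insert d B) (f(d := f d + x)) (insert c C) (g(c := g c + x))"
    using reachable_step[OF A r x] c(1) by blast
  have "d \<notin> B" using d full by force
  then show ?thesis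
    using step c(2) reachable_finite(1)[OF r] reachable_outside(1)[OF r] by auto
qed

text \<open>The Any-Fit rule is exploited here: the algorithm is kept from opening a bin, while the
  offline packing may open one at the expense of the waste.\<close>

lemma reachable_old_bin:
  assumes A: "any_fit A" and r: "reachable A B f C g" and x: "0 < x" "x \<le> 1"
    and fits: "\<exists>b\<in>B. f b + x \<le> 1"
  shows "\<exists>d. d \<in> B \<and> f d + x \<le> 1 \<and> (\<forall>c. g c + x \<le> 1 \<longrightarrow> card (insert c C) \<le> card B \<longrightarrow>
      reachable A B (f(d := f d + x)) (insert c C) (g(c := g c + x)))"
proof -
  obtain d where "d \<in> B" "f d + x \<le> 1"
    and "\<forall>c. g c + x \<le> 1 \<longrightarrow> card (insert c C) \<le> card (insert d B) \<longrightarrow>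
      reachable A (insert d B) (f(d := f d + x)) (insert c C) (g(c := g c + x))"
    using reachable_step[OF A r x] fits by blast
  then show ?thesis by (intro exI[of _ d]) (simp add: insert_absorb)
qed

lemma fresh_bin:
  assumes "reachable A B f C g"
  obtains c where "c \<notin> C" "g c = 0" "card (insert c C) = Suc (card C)"
proof -
  obtain c where "c \<notin> C"
    using ex_new_if_finite[OF infinite_UNIV_nat reachable_finite(2)[OF assms]] by blast
  then show ?thesis
    using that reachable_outside(2)[OF assms] reachable_finite(2)[OF assms] by simp
qed

section \<open>A first unit of waste\<close>

lemma initial_waste:
  assumes A: "any_fit A"
  shows "\<exists>B f C g. reachable A B f C g \<and> card B = Suc (card C) \<and> card C \<le> 3 \<and>
    (\<forall>b\<in>B. f b \<ge> 11/20)"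
proof -
  \<comment> \<open>The offline bins get the fixed labels 0, 1, 2; the labels of the algorithm's
    bins are its own choice.\<close>
  have "\<exists>a. a \<notin> {} \<and> reachable A {a} ((\<lambda>_. 0)(a := 2/5)) {0} ((\<lambda>_. 0)(0 := 0 + 2/5))"
    by (rule reachable_new_bin[OF A reachable_empty]) simp_all
  then obtain a f1 g1 where r1: "reachable A {a} f1 {0} g1"
    and f1: "f1 a = 2/5" and g1: "g1 0 = 2/5" "g1 1 = 0" "g1 2 = 0"
    by (metis add_0 fun_upd_apply zero_neq_one zero_neq_numeral)
  have "\<exists>b. b \<notin> {a} \<and> reachable A {b, a} (f1(b := 7/10)) {1, 0} (g1(1 := g1 1 + 7/10))"
    by (rule reachable_new_bin[OF A r1]) (simp_all add: f1 g1 del: One_nat_def)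
  then obtain b where ab: "b \<noteq> a"
    and r2: "reachable A {b, a} (f1(b := 7/10)) {1, 0} (g1(1 := g1 1 + 7/10))"
    by blast
  define f2 where "f2 = f1(b := 7/10)"
  define g2 where "g2 = g1(1 := g1 1 + 7/10)"
  have f2: "f2 a = 2/5" "f2 b = 7/10" using ab f1 by (auto simp: f2_def)
  have g2: "g2 0 = 2/5" "g2 1 = 7/10" "g2 2 = 0" using g1 by (auto simp: g2_def simp del: One_nat_def)
  have r2: "reachable A {b, a} f2 {1, 0} g2" using r2 by (simp add: f2_def g2_def)
  have "\<exists>d. d \<in> {b, a} \<and> f2 d + 1/5 \<le> 1 \<and> (\<forall>c. g2 c + 1/5 \<le> 1 \<longrightarrow>
      card (insert c {1, 0}) \<le> card {b, a} \<longrightarrow>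
      reachable A {b, a} (f2(d := f2 d + 1/5)) (insert c {1, 0}) (g2(c := g2 c + 1/5)))"
    by (rule reachable_old_bin[OF A r2]) (simp_all add: f2 del: One_nat_def)
  then obtain d where d: "d \<in> {b, a}" and r3: "\<And>c. g2 c + 1/5 \<le> 1 \<Longrightarrow>
      card (insert c {1, 0}) \<le> card {b, a} \<Longrightarrow>
      reachable A {b, a} (f2(d := f2 d + 1/5)) (insert c {1, 0}) (g2(c := g2 c + 1/5))"
    by blast
  show ?thesis
  proof (cases "d = a")
    case True
    \<comment> \<open>Offline, the third item goes on the other bin, so the bin of load
      \<open>2/5\<close> keeps exactly the room for an item \<open>3/5\<close>. That item overflows
      the algorithm's loads \<open>3/5\<close> and \<open>7/10\<close>.\<close>
    define f3 where "f3 = f2(a := f2 a + 1/5)"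
    define g3 where "g3 = g2(1 := g2 1 + 1/5)"
    have f3: "f3 a = 3/5" "f3 b = 7/10" using ab f2 by (auto simp: f3_def)
    have g3: "g3 0 = 2/5" "g3 1 = 9/10" using g2 by (auto simp: g3_def simp del: One_nat_def)
    have r4: "reachable A {b, a} f3 {1, 0} g3"
      using r3[of 1] True ab by (simp add: f3_def g3_def g2 del: One_nat_def)
    have "\<exists>h. h \<notin> {b, a} \<and>
        reachable A {h, b, a} (f3(h := 3/5)) (insert 0 {1, 0}) (g3(0 := g3 0 + 3/5))"
      by (rule reachable_new_bin[OF A r4]) (use ab in \<open>simp_all add: f3 g3 insert_absorb del: One_nat_def\<close>)
    then obtain h where h: "h \<notin> {b, a}"
      and r5: "reachable A {h, b, a} (f3(h := 3/5)) (insert 0 {1, 0}) (g3(0 := g3 0 + 3/5))"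
      by blast
    show ?thesis
      by (intro exI conjI, rule r5) (use ab h f3 in \<open>auto simp: insert_absorb\<close>)
  next
    case False
    then have db: "d = b" using d by simp
    \<comment> \<open>Now the algorithm has loads \<open>2/5\<close>, \<open>9/10\<close> against
      \<open>3/5\<close>, \<open>7/10\<close> offline. An item \<open>3/10\<close> is forced into
      \<open>a\<close> and fills offline bin 1; then \<open>2/5\<close> overflows both of the
      algorithm's bins and fills offline bin 0.\<close>
    define f3 where "f3 = f2(b := f2 b + 1/5)"
    define g3 where "g3 = g2(0 := g2 0 + 1/5)"
    have f3: "f3 a = 2/5" "f3 b = 9/10" using ab f2 by (auto simp: f3_def)
    have g3: "g3 0 = 3/5" "g3 1 = 7/10" "g3 2 = 0" using g2 by (auto simp: g3_def simp del: One_nat_def)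
    have r4: "reachable A {b, a} f3 {1, 0} g3"
      using r3[of 0] db ab by (simp add: f3_def g3_def g2 insert_absorb del: One_nat_def)
    have "\<exists>d. d \<in> {b, a} \<and> f3 d + 3/10 \<le> 1 \<and> (\<forall>c. g3 c + 3/10 \<le> 1 \<longrightarrow>
        card (insert c {1, 0}) \<le> card {b, a} \<longrightarrow>
        reachable A {b, a} (f3(d := f3 d + 3/10)) (insert c {1, 0}) (g3(c := g3 c + 3/10)))"
      by (rule reachable_old_bin[OF A r4]) (simp_all add: f3 del: One_nat_def)
    then obtain d' where d': "d' \<in> {b, a}" "f3 d' + 3/10 \<le> 1"
      and r: "\<And>c. g3 c + 3/10 \<le> 1 \<Longrightarrow> card (insert c {1, 0}) \<le> card {b, a} \<Longrightarrow>
        reachable A {b, a} (f3(d' := f3 d' + 3/10)) (insert c {1, 0}) (g3(c := g3 c + 3/10))"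
      by blast
    have "d' = a" using d' f3 by auto
    define f4 where "f4 = f3(a := f3 a + 3/10)"
    define g4 where "g4 = g3(1 := g3 1 + 3/10)"
    have f4: "f4 a = 7/10" "f4 b = 9/10" using ab f3 by (auto simp: f4_def)
    have g4: "g4 0 = 3/5" "g4 1 = 1" "g4 2 = 0" using g3 by (auto simp: g4_def simp del: One_nat_def)
    have r5: "reachable A {b, a} f4 {1, 0} g4"
      using r[of 1] \<open>d' = a\<close> ab by (simp add: f4_def g4_def g3 del: One_nat_def)
    have "\<exists>h. h \<notin> {b, a} \<and>
        reachable A {h, b, a} (f4(h := 2/5)) (insert 0 {1, 0}) (g4(0 := g4 0 + 2/5))"
      by (rule reachable_new_bin[OF A r5]) (use ab in \<open>simp_all add: f4 g4 insert_absorb del: One_nat_def\<close>)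
    then obtain h where h: "h \<notin> {b, a}"
      and r6: "reachable A {h, b, a} (f4(h := 2/5)) (insert 0 {1, 0}) (g4(0 := g4 0 + 2/5))"
      by blast
    define f5 where "f5 = f4(h := 2/5)"
    define g5 where "g5 = g4(0 := g4 0 + 2/5)"
    have f5: "f5 a = 7/10" "f5 b = 9/10" "f5 h = 2/5" using h f4 by (auto simp: f5_def)
    have g5: "g5 2 = 0" using g4 by (auto simp: g5_def simp del: One_nat_def)
    have r6: "reachable A {h, b, a} f5 {1, 0} g5"
      using r6 by (simp add: f5_def g5_def insert_absorb)
    txt \<open>
      The waste is 1 already, but bin \<open>h\<close> with load \<open>2/5\<close> would still accept items just below
      \<open>1/2\<close>. Two more items repair this without changing the waste.
    \<close>
    have "\<exists>d. d \<in> {h, b, a} \<and> f5 d + 9/20 \<le> 1 \<and> (\<forall>c. g5 c + 9/20 \<le> 1 \<longrightarrow>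
        card (insert c {1, 0}) \<le> card {h, b, a} \<longrightarrow>
        reachable A {h, b, a} (f5(d := f5 d + 9/20)) (insert c {1, 0}) (g5(c := g5 c + 9/20)))"
      by (rule reachable_old_bin[OF A r6]) (simp_all add: f5 del: One_nat_def)
    then obtain d'' where d'': "d'' \<in> {h, b, a}" "f5 d'' + 9/20 \<le> 1"
      and r: "\<And>c. g5 c + 9/20 \<le> 1 \<Longrightarrow> card (insert c {1, 0}) \<le> card {h, b, a} \<Longrightarrow>
        reachable A {h, b, a} (f5(d'' := f5 d'' + 9/20)) (insert c {1, 0}) (g5(c := g5 c + 9/20))"
      by blast
    have "d'' = h" using d'' f5 by auto
    define f6 where "f6 = f5(h := f5 h + 9/20)"
    define g6 where "g6 = g5(2 := g5 2 + 9/20)"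
    have f6: "f6 a = 7/10" "f6 b = 9/10" "f6 h = 17/20" using h f5 by (auto simp: f6_def)
    have g6: "g6 2 = 9/20" using g5 by (auto simp: g6_def simp del: One_nat_def)
    have r7: "reachable A {h, b, a} f6 {2, 1, 0} g6"
      using r[of 2] \<open>d'' = h\<close> ab h by (simp add: f6_def g6_def g5 del: One_nat_def)
    \<comment> \<open>Opening offline bin 2 for the item \<open>9/20\<close> has spent the waste.
      The complement \<open>11/20\<close> fills that bin and overflows all bins of the algorithm,
      which regains it.\<close>
    have "\<exists>k. k \<notin> {h, b, a} \<and>
        reachable A {k, h, b, a} (f6(k := 11/20)) (insert 2 {2, 1, 0}) (g6(2 := g6 2 + 11/20))"
      by (rule reachable_new_bin[OF A r7]) (use ab h in \<open>simp_all add: f6 g6 insert_absorb del: One_nat_def\<close>)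
    then obtain k where k: "k \<notin> {h, b, a}"
      and r8: "reachable A {k, h, b, a} (f6(k := 11/20)) (insert 2 {2, 1, 0}) (g6(2 := g6 2 + 11/20))"
      by blast
    show ?thesis
      by (intro exI conjI, rule r8) (use ab h k f6 in \<open>auto simp: insert_absorb\<close>)
  qed
qed

section \<open>One round: small items spend the waste, big items earn it back twofold\<close>

text \<open>Two items of size \<open>1/2 - e\<close> cost the algorithm one bin and the offline
  packing two, so one unit of waste is spent. Both offline bins keep room for an item
  \<open>1/2 + e\<close>.\<close>

lemma small_pair:
  assumes A: "any_fit A" and r: "reachable A B f C g" and e: "0 < e" "e \<le> 1/8"
    and full: "\<forall>b\<in>B. f b \<ge> 1/2 + 2 * e" and waste: "card C < card B"
  shows "\<exists>B' f' c c'. reachable A B' f' (insert c' (insert c C)) (g(c := 1/2 - e, c' := 1/2 - e)) \<and>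
    c \<notin> C \<and> c' \<notin> insert c C \<and> card B' = Suc (card B) \<and> (\<forall>b\<in>B'. f' b \<ge> 1/2 + 2 * e)"
proof -
  obtain c where c: "c \<notin> C" "g c = 0" "card (insert c C) = Suc (card C)"
    using fresh_bin[OF r] .
  have "\<forall>b\<in>B. f b + (1/2 - e) > 1" using full e by force
  then obtain d where d: "d \<notin> B"
    and r1: "reachable A (insert d B) (f(d := 1/2 - e)) (insert c C) (g(c := 1/2 - e))"
    using reachable_new_bin[OF A r, of "1/2 - e" c] c waste e by auto
  let ?f = "f(d := 1/2 - e)" and ?g = "g(c := 1/2 - e)"
  obtain c' where c': "c' \<notin> insert c C" "?g c' = 0" "card (insert c' (insert c C)) = Suc (Suc (card C))"
    using fresh_bin[OF r1] c(3) by metis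
  have cardB: "card (insert d B) = Suc (card B)" using d reachable_finite(1)[OF r] by simp
  have size: "0 < 1/2 - e" "1/2 - e \<le> 1" using e by auto
  have "\<exists>b\<in>insert d B. ?f b + (1/2 - e) \<le> 1" using e by force
  from reachable_old_bin[OF A r1 size this]
  obtain d' where d': "d' \<in> insert d B" "?f d' + (1/2 - e) \<le> 1"
    and r2: "\<forall>k. ?g k + (1/2 - e) \<le> 1 \<longrightarrow> card (insert k (insert c C)) \<le> card (insert d B) \<longrightarrow>
      reachable A (insert d B) (?f(d' := ?f d' + (1/2 - e))) (insert k (insert c C))
        (?g(k := ?g k + (1/2 - e)))"
    by blast
  \<comment> \<open>Any bin of \<open>B\<close> would reach at least \<open>1 + e\<close>, so the
    second item joins the first.\<close>
  have "d' = d" using d' full e by (force split: if_splits)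
  then have "reachable A (insert d B) (?f(d := 1 - 2 * e)) (insert c' (insert c C)) (?g(c' := 1/2 - e))"
    using r2[rule_format, of c'] c' cardB waste e by simp
  \<comment> \<open>The bound \<open>e \<le> 1/8\<close> says exactly that the load
    \<open>1 - 2 * e\<close> of a pair is at least \<open>1/2 + 2 * e\<close>.\<close>
  moreover have "\<forall>b\<in>insert d B. (?f(d := 1 - 2 * e)) b \<ge> 1/2 + 2 * e" using full e by auto
  ultimately show ?thesis using c(1) c'(1) cardB by blast
qed

text \<open>Iterates the pair \<open>j\<close> times, as far as the waste allows. \<open>S\<close>
  collects the new offline bins, which the big items will fill.\<close>

lemma small_items:
  assumes A: "any_fit A" and r: "reachable A B f C g" and e: "0 < e" "e \<le> 1/8"
    and full: "\<forall>b\<in>B. f b \<ge> 1/2 + 2 * e" and waste: "card C + j \<le> card B"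
  shows "\<exists>B' f' C' g' S. reachable A B' f' C' g' \<and> (\<forall>b\<in>B'. f' b \<ge> 1/2 + 2 * e) \<and>
    card B' = card B + j \<and> card C' = card C + 2 * j \<and>
    S \<subseteq> C' \<and> card S = 2 * j \<and> (\<forall>c\<in>S. g' c = 1/2 - e)"
  using waste
proof (induction j)
  case 0
  show ?case
    using r full by (intro exI[of _ B] exI[of _ f] exI[of _ C] exI[of _ g] exI[of _ "{}"]) simp
next
  case (Suc j)
  then obtain B' f' C' g' S where r': "reachable A B' f' C' g'"
    and full': "\<forall>b\<in>B'. f' b \<ge> 1/2 + 2 * e"
    and cards: "card B' = card B + j" "card C' = card C + 2 * j"
    and S: "S \<subseteq> C'" "card S = 2 * j" "\<forall>c\<in>S. g' c = 1/2 - e"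
    by auto
  have "card C' < card B'" using cards Suc.prems by simp
  from small_pair[OF A r' e full' this] obtain B'' f'' c c' where
    r'': "reachable A B'' f'' (insert c' (insert c C')) (g'(c := 1/2 - e, c' := 1/2 - e))"
    and c: "c \<notin> C'" "c' \<notin> insert c C'" and B'': "card B'' = Suc (card B')"
    and full'': "\<forall>b\<in>B''. f'' b \<ge> 1/2 + 2 * e"
    by blast
  have fin: "finite C'" using reachable_finite(2)[OF r'] .
  then have "finite S" using S(1) finite_subset by blast
  then have "card (insert c' (insert c S)) = 2 * Suc j" using c S by (subst card_insert_disjoint; force)
  moreover have "card (insert c' (insert c C')) = card C + 2 * Suc j" using c fin cards by simp
  moreover have "\<forall>k\<in>insert c' (insert c S). (g'(c := 1/2 - e, c' := 1/2 - e)) k = 1/2 - e"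
    using S by auto
  moreover have "insert c' (insert c S) \<subseteq> insert c' (insert c C')" using S(1) by blast
  moreover have "card B'' = card B + Suc j" using B'' cards by simp
  ultimately show ?case using r'' full''
    by (intro exI[of _ B''] exI[of _ f''] exI[of _ "insert c' (insert c C')"]
        exI[of _ "g'(c := 1/2 - e, c' := 1/2 - e)"] exI[of _ "insert c' (insert c S)"] conjI)
qed

text \<open>An item \<open>1/2 + e\<close> overflows every bin of load at least
  \<open>1/2 + e\<close> and starts another such bin, so the invariant persists. Offline it fills a
  bin of \<open>S\<close> to exactly 1, leaving \<open>C\<close> as it is.\<close>

lemma big_items:
  assumes A: "any_fit A" and e: "0 < e" "e \<le> 1/8"
  shows "reachable A B f C g \<Longrightarrow> \<forall>b\<in>B. f b \<ge> 1/2 + e \<Longrightarrow>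
    S \<subseteq> C \<Longrightarrow> card S = k \<Longrightarrow> \<forall>c\<in>S. g c = 1/2 - e \<Longrightarrow>
    \<exists>B' f' g'. reachable A B' f' C g' \<and> (\<forall>b\<in>B'. f' b \<ge> 1/2 + e) \<and> card B' = card B + k"
proof (induction k arbitrary: B f g S)
  case 0
  then show ?case by auto
next
  case (Suc k)
  have "finite S" using Suc.prems(3) reachable_finite(2)[OF Suc.prems(1)] finite_subset by blast
  obtain c where c: "c \<in> S" using Suc.prems(4) by fastforce
  have "insert c C = C" using c Suc.prems(3) by blast
  moreover have "\<forall>b\<in>B. f b + (1/2 + e) > 1" using Suc.prems(2) e by force
  ultimately obtain d where d: "d \<notin> B"
    and r: "reachable A (insert d B) (f(d := 1/2 + e)) C (g(c := 1))"
    using reachable_new_bin[OF A Suc.prems(1), of "1/2 + e" c] c Suc.prems(5)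
      reachable_card_le[OF Suc.prems(1)] e by auto
  \<comment> \<open>The bin \<open>c\<close> is full now and leaves \<open>S\<close>; the other bins
    of \<open>S\<close> keep their loads.\<close>
  have "\<exists>B' f' g'. reachable A B' f' C g' \<and> (\<forall>b\<in>B'. f' b \<ge> 1/2 + e)
      \<and> card B' = card (insert d B) + k"
    by (rule Suc.IH[OF r, of "S - {c}"]) (use Suc.prems c \<open>finite S\<close> in auto)
  then show ?case using d reachable_finite(1)[OF Suc.prems(1)] by simp
qed

section \<open>Iterating the rounds and bounding the ratio\<close>

text \<open>Round \<open>j\<close> adds \<open>3 * 2 ^ j\<close> bins for the algorithm and
  \<open>2 * 2 ^ j\<close> offline. Starting from at most 3 offline bins, the sum is at most
  \<open>3 + 2 * (2 ^ j - 1) = 2 ^ (j + 1) + 1\<close> before round \<open>j\<close>.\<close>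

lemma waste_doubling:
  assumes A: "any_fit A"
  shows "\<exists>B f C g e. reachable A B f C g \<and> card B = card C + 2 ^ j \<and> card C \<le> 2 ^ (j + 1) + 1 \<and>
    0 < e \<and> e \<le> 1/8 \<and> (\<forall>b\<in>B. f b \<ge> 1/2 + e)"
proof (induction j)
  case 0
  obtain B f C g where "reachable A B f C g" "card B = Suc (card C)" "card C \<le> 3"
    and "\<forall>b\<in>B. f b \<ge> 11/20"
    using initial_waste[OF A] by blast
  then show ?case
    by (intro exI[of _ B] exI[of _ f] exI[of _ C] exI[of _ g] exI[of _ "1/20"]) auto
next
  case (Suc j)
  then obtain B f C g e where r: "reachable A B f C g"
    and cards: "card B = card C + 2 ^ j" "card C \<le> 2 ^ (j + 1) + 1"
    and e: "0 < e" "e \<le> 1/8" and full: "\<forall>b\<in>B. f b \<ge> 1/2 + e"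
    by blast
  \<comment> \<open>The round is played with \<open>e/2\<close>: the small items need loads
    \<open>1/2 + 2 * (e/2)\<close>, which is the invariant, and the big items leave loads of at
    least \<open>1/2 + e/2\<close>.\<close>
  have e': "0 < e/2" "e/2 \<le> 1/8" using e by auto
  obtain B' f' C' g' S where r': "reachable A B' f' C' g'"
    and full': "\<forall>b\<in>B'. f' b \<ge> 1/2 + 2 * (e/2)"
    and cards': "card B' = card B + 2 ^ j" "card C' = card C + 2 * 2 ^ j"
    and S: "S \<subseteq> C'" "card S = 2 * 2 ^ j" "\<forall>c\<in>S. g' c = 1/2 - e/2"
    using small_items[OF A r e', of "2 ^ j"] full cards by auto
  have "\<forall>b\<in>B'. f' b \<ge> 1/2 + e/2" using full' e by force
  from big_items[OF A e' r' this S] obtain B'' f'' g'' where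
    "reachable A B'' f'' C' g''" "\<forall>b\<in>B''. f'' b \<ge> 1/2 + e/2" "card B'' = card B' + 2 * 2 ^ j"
    by blast
  then show ?case using cards cards' e'
    by (intro exI[of _ B''] exI[of _ f''] exI[of _ C'] exI[of _ g''] exI[of _ "e/2"]) auto
qed

text \<open>An admissible packing bounds the offline optimum from above, the direction needed for a
  lower bound on the ratio.\<close>

lemma reachable_cost:
  assumes "reachable A B f C g"
  obtains I where "valid_input I" "cost A I = card B" "opt_cost A I \<le> card C"
  using assms opt_cost_le unfolding reachable_def cost_def by metis

theorem theorem9:
  fixes A :: "real list \<Rightarrow> nat"
  assumes "any_fit A"
  shows "online_bounded_ratio A \<ge> ereal (3/2)"
proof -
  have "3/2 \<le> c"
    if bound: "\<forall>I. valid_input I \<longrightarrow> real (cost A I) \<le> c * real (opt_cost A I) + \<alpha>"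
    for c \<alpha> :: real
  proof (rule ccontr)
    assume "\<not> 3/2 \<le> c"
    \<comment> \<open>Raising \<open>c\<close> to at least 1 makes \<open>m\<close> and
      \<open>m - 1\<close> nonnegative, so that upper bounds on \<open>opt_cost A I\<close> and
      \<open>card C\<close> can be inserted.\<close>
    define m where "m = max c 1"
    have m: "1 \<le> m" "c \<le> m" "m < 3/2" using \<open>\<not> 3/2 \<le> c\<close> by (auto simp: m_def)
    \<comment> \<open>Since \<open>m < 3/2\<close>, the left side grows without bound in
      \<open>j\<close>, whereas the right side is constant.\<close>
    have small: "2 ^ j * (3 - 2 * m) \<le> (m - 1) + \<alpha>" for j :: nat
    proof -
      obtain B f C g where r: "reachable A B f C g"
        and cards: "card B = card C + 2 ^ j" "card C \<le> 2 ^ (j + 1) + 1"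
        using waste_doubling[OF assms, of j] by blast
      obtain I where I: "valid_input I" "cost A I = card B" "opt_cost A I \<le> card C"
        using reachable_cost[OF r] .
      have "real (card C) + 2 ^ j \<le> c * real (opt_cost A I) + \<alpha>"
        using bound[rule_format, OF I(1)] I(2) cards(1) by simp
      also have "\<dots> \<le> m * real (card C) + \<alpha>"
        using m I(3) by (intro add_right_mono mult_mono) auto
      finally have "2 ^ j \<le> (m - 1) * real (card C) + \<alpha>" by (simp add: algebra_simps)
      also have "\<dots> \<le> (m - 1) * (2 ^ (j + 1) + 1) + \<alpha>"
        using m of_nat_mono[OF cards(2), where ?'a = real]
        by (intro add_right_mono mult_left_mono) auto
      finally show ?thesis by (simp add: algebra_simps)
    qed
    obtain j :: nat where "(m - 1 + \<alpha>) / (3 - 2 * m) < 2 ^ j"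
      using real_arch_pow[of 2] by auto
    then show False using small[of j] m by (simp add: field_simps)
  qed
  then show ?thesis
    unfolding online_bounded_ratio_def by (intro Inf_greatest) force
qed

end
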